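(* Let $\alpha<0$ and let $\sigma>0$ be fixed. For $\rho>0$ put $\theta=\rho/\sigma$ (so that $\rho/\theta=\sigma$ stays fixed), and let $f(\cdot;\alpha,\theta,\rho)$ be the full-tails gamma (FTG) probability density function on $(0,\infty)$ with parameters $(\alpha,\theta,\rho)$. Let $p(\cdot;\alpha,\sigma)$ be the Pareto probability density function on $(0,\infty)$ with parameters $(\alpha,\sigma)$. Then, as $\rho\to 0^+$, $f(\cdot;\alpha,\rho/\sigma,\rho)$ tends to $p(\cdot;\alpha,\sigma)$ in $L^1$ norm, i.e. $$\lim_{\rho\to0^+}\int_0^\infty \bigl|f(x;\alpha,\rho/\sigma,\rho)-p(x;\alpha,\sigma)\bigr|\,dx=0.$$ Moreover, the convergence extends to the moments, provided the corresponding moments of the Pareto distribution are finite: for every positive integer $k$ such that $\int_0^\infty x^k p(x;\alpha,\sigma)\,dx<\infty$, $$\lim_{\rho\to0^+}\int_0^\infty x^k f(x;\alpha,\rho/\sigma,\rho)\,dx=\int_0^\infty x^k p(x;\alpha,\sigma)\,dx.$$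
   Context: For $\alpha\in\mathbb{R}$ and $\rho>0$, the (upper) incomplete gamma function is $\Gamma(\alpha,\rho)=\int_\rho^\infty t^{\alpha-1}e^{-t}\,dt$. The full-tails gamma (FTG) distribution with parameters $\alpha\in\mathbb{R}$, $\theta>0$, $\rho>0$ is the continuous probability distribution on $(0,\infty)$ with density $$f(x;\alpha,\theta,\rho)=\frac{\theta(\rho+\theta x)^{\alpha-1}\exp(-(\rho+\theta x))}{\Gamma(\alpha,\rho)},\qquad x>0.$$ The Pareto distribution with parameters $\alpha<0$, $\sigma>0$ is the probability distribution on $(0,\infty)$ with density $$p(x;\alpha,\sigma)=-\alpha\,\sigma^{-1}(1+x/\sigma)^{\alpha-1},\qquad x>0.$$ *)

theory Defs
  imports "HOL-Analysis.Analysis"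
begin

(* The integrand is integrable over {\<rho>..} for every real \<alpha> as soon as \<rho> > 0; the
   constant is only meaningful in that range. *)
definition upper_incomplete_Gamma :: "real \<Rightarrow> real \<Rightarrow> real" where
  "upper_incomplete_Gamma \<alpha> \<rho> = (LBINT t:{\<rho>..}. t powr (\<alpha> - 1) * exp (- t))"

definition ftg_density :: "real \<Rightarrow> real \<Rightarrow> real \<Rightarrow> real \<Rightarrow> real" where
  "ftg_density \<alpha> \<theta> \<rho> x =
     (if x > 0
      then \<theta> * (\<rho> + \<theta> * x) powr (\<alpha> - 1) * exp (- (\<rho> + \<theta> * x)) / upper_incomplete_Gamma \<alpha> \<rho>
      else 0)"

definition pareto_density :: "real \<Rightarrow> real \<Rightarrow> real \<Rightarrow> real" where
  "pareto_density \<alpha> \<sigma> x =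
     (if x > 0 then - \<alpha> * inverse \<sigma> * (1 + x / \<sigma>) powr (\<alpha> - 1) else 0)"

end

theory Submission
  imports Defs
begin

text \<open>
  Substituting \<open>t = \<rho> (1 + x / \<sigma>)\<close> in the incomplete gamma integral shows that, along the curve
  \<open>\<theta> = \<rho> / \<sigma>\<close>, the FTG density is an exponentially tempered Pareto density. Writing \<open>p\<close> for the
  Pareto density and \<open>e\<^sub>\<rho>(x) = exp (- \<rho> (1 + x / \<sigma>))\<close>,
    \<open>f\<^sub>\<rho> = p e\<^sub>\<rho> / I(\<rho>)\<close>  with  \<open>I(\<rho>) = \<integral> p e\<^sub>\<rho>\<close>
  (lemma \<open>ftg_density_eq_tempered_pareto\<close>); all powers of \<open>\<rho>\<close> cancel between the numerator and
  the normalising constant.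

  On the support of \<open>p\<close> the factor \<open>e\<^sub>\<rho>\<close> lies in \<open>[0, 1]\<close> and increases to \<open>1\<close> as \<open>\<rho>\<close> decreases to
  \<open>0\<close>, so by dominated convergence \<open>\<integral> g e\<^sub>\<rho> \<longlongrightarrow> \<integral> g\<close> for every integrable \<open>g\<close> supported there
  (lemma \<open>tendsto_integral_exp_tempered\<close>). For \<open>g = p\<close> this says \<open>I(\<rho>) \<longlongrightarrow> 1\<close>, and for
  \<open>g = x\<^sup>k p\<close> it then gives the convergence of the \<open>k\<close>-th moment, \<open>(\<integral> x\<^sup>k p e\<^sub>\<rho>) / I(\<rho>)\<close>.

  For the \<open>L\<^sup>1\<close> distance, compare both densities with the common minorant \<open>p e\<^sub>\<rho>\<close>: it lies below \<open>p\<close>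
  because \<open>e\<^sub>\<rho> \<le> 1\<close>, and below \<open>f\<^sub>\<rho>\<close> because \<open>I(\<rho>) \<le> 1\<close>. Both densities have mass \<open>1\<close> and the
  minorant has mass \<open>I(\<rho>)\<close>, so the distance is at most \<open>2 (1 - I(\<rho>))\<close>.
\<close>

section \<open>Exponential tempering of an integrable function\<close>

text \<open>
  Abel summation for integrals: the tempered integrands are dominated by \<open>\<bar>g\<bar>\<close>. The limit is taken
  along \<open>\<rho> = 1 / y\<close> with \<open>y\<close> tending to infinity, where dominated convergence for a real parameter
  applies.
\<close>
lemma tendsto_integral_exp_tempered:
  fixes g h :: "'a \<Rightarrow> real"
  assumes g: "integrable M g" and h [measurable]: "h \<in> borel_measurable M"
    and nonneg: "\<And>x. g x \<noteq> 0 \<Longrightarrow> 0 \<le> h x"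
  shows "((\<lambda>\<rho>. \<integral>x. g x * exp (- (\<rho> * h x)) \<partial>M) \<longlongrightarrow> (\<integral>x. g x \<partial>M)) (at_right 0)"
proof -
  have [measurable]: "g \<in> borel_measurable M"
    using g by auto
  have "((\<lambda>y. \<integral>x. g x * exp (- (inverse y * h x)) \<partial>M) \<longlongrightarrow> (\<integral>x. g x \<partial>M)) at_top"
  proof (rule integral_dominated_convergence_at_top[where w = "\<lambda>x. \<bar>g x\<bar>"])
    show "AE x in M. ((\<lambda>y. g x * exp (- (inverse y * h x))) \<longlongrightarrow> g x) at_top"
    proof (rule AE_I2)
      fix x
      have "((\<lambda>y::real. g x * exp (- (inverse y * h x))) \<longlongrightarrow> g x * exp (- (0 * h x))) at_top"
        by (intro tendsto_intros tendsto_inverse_0_at_top filterlim_ident)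
      then show "((\<lambda>y. g x * exp (- (inverse y * h x))) \<longlongrightarrow> g x) at_top"
        by simp
    qed
    show "\<forall>\<^sub>F y::real in at_top. AE x in M. norm (g x * exp (- (inverse y * h x))) \<le> \<bar>g x\<bar>"
      using eventually_gt_at_top[of "0::real"]
    proof eventually_elim
      case (elim y)
      have "norm (g x * exp (- (inverse y * h x))) \<le> \<bar>g x\<bar>" for x
        using elim nonneg[of x] by (cases "g x = 0") (auto simp: abs_mult intro!: mult_left_le)
      then show ?case by simp
    qed
  qed (use g in auto)
  then show ?thesis
    by (simp add: filterlim_at_right_to_top)
qed

lemma integrable_exp_tempered:
  fixes g h :: "'a \<Rightarrow> real"
  assumes g: "integrable M g" and h [measurable]: "h \<in> borel_measurable M"
    and nonneg: "\<And>x. g x \<noteq> 0 \<Longrightarrow> 0 \<le> h x" and "0 \<le> \<rho>"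
  shows "integrable M (\<lambda>x. g x * exp (- (\<rho> * h x)))"
proof (rule Bochner_Integration.integrable_bound[OF g])
  have [measurable]: "g \<in> borel_measurable M"
    using g by auto
  show "(\<lambda>x. g x * exp (- (\<rho> * h x))) \<in> borel_measurable M"
    by measurable
  have "norm (g x * exp (- (\<rho> * h x))) \<le> norm (g x)" for x
    using \<open>0 \<le> \<rho>\<close> nonneg[of x] by (cases "g x = 0") (auto simp: abs_mult intro!: mult_left_le)
  then show "AE x in M. norm (g x * exp (- (\<rho> * h x))) \<le> norm (g x)"
    by simp
qed

section \<open>The Pareto density\<close>

lemma borel_measurable_pareto_density [measurable]:
  "pareto_density \<alpha> \<sigma> \<in> borel_measurable borel"
  unfolding pareto_density_def by measurable

lemma borel_measurable_ftg_density [measurable]: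
  "ftg_density \<alpha> \<theta> \<rho> \<in> borel_measurable borel"
  unfolding ftg_density_def by measurable

lemma pareto_density_nonneg: "\<alpha> < 0 \<Longrightarrow> \<sigma> > 0 \<Longrightarrow> 0 \<le> pareto_density \<alpha> \<sigma> x"
  unfolding pareto_density_def by (auto intro!: mult_nonpos_nonneg)

text \<open>The survival function \<open>(1 + x / \<sigma>) powr \<alpha>\<close> is, up to sign, an antiderivative.\<close>
lemma nn_integral_pareto_density:
  assumes "\<alpha> < 0" "\<sigma> > 0"
  shows "(\<integral>\<^sup>+x. ennreal (pareto_density \<alpha> \<sigma> x) \<partial>lborel) = 1"
proof -
  let ?d = "\<lambda>x. - \<alpha> * inverse \<sigma> * (1 + x / \<sigma>) powr (\<alpha> - 1)"
  let ?F = "\<lambda>x. - ((1 + x / \<sigma>) powr \<alpha>)"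
  have "(\<integral>\<^sup>+x. ennreal (?d x) * indicator {0..} x \<partial>lborel) = ennreal (0 - ?F 0)"
  proof (rule nn_integral_FTC_atLeast)
    fix x :: real assume "0 \<le> x"
    then have "0 < 1 + x / \<sigma>"
      using assms by (auto intro: add_pos_nonneg)
    then show "DERIV ?F x :> ?d x"
      using assms by (auto intro!: derivative_eq_intros simp: field_simps)
    show "0 \<le> ?d x"
      using assms by (auto intro!: mult_nonpos_nonneg)
  next
    have "filterlim (\<lambda>x. 1 + x / \<sigma>) at_top at_top"
      unfolding divide_inverse using assms
      by (intro filterlim_tendsto_add_at_top[OF tendsto_const]
          filterlim_at_top_mult_tendsto_pos[OF tendsto_const] filterlim_ident) auto
    then have "((\<lambda>x. (1 + x / \<sigma>) powr \<alpha>) \<longlongrightarrow> 0) at_top"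
      using assms by (intro tendsto_neg_powr)
    from tendsto_minus[OF this] show "(?F \<longlongrightarrow> 0) at_top"
      by simp
  qed measurable
  moreover have "(\<integral>\<^sup>+x. ennreal (pareto_density \<alpha> \<sigma> x) \<partial>lborel) =
      (\<integral>\<^sup>+x. ennreal (?d x) * indicator {0..} x \<partial>lborel)"
  proof (rule nn_integral_cong_AE)
    show "AE x in lborel. ennreal (pareto_density \<alpha> \<sigma> x) = ennreal (?d x) * indicator {0..} x"
      using AE_lborel_singleton[of "0::real"]
      by eventually_elim (auto simp: pareto_density_def indicator_def)
  qed
  ultimately show ?thesis
    by simp
qed

lemma
  assumes "\<alpha> < 0" "\<sigma> > 0"
  shows integrable_pareto_density: "integrable lborel (pareto_density \<alpha> \<sigma>)"
    and integral_pareto_density: "(\<integral>x. pareto_density \<alpha> \<sigma> x \<partial>lborel) = 1"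
proof -
  show "integrable lborel (pareto_density \<alpha> \<sigma>)"
    using nn_integral_pareto_density[OF assms] pareto_density_nonneg[OF assms]
    by (intro integrableI_nonneg) auto
  show "(\<integral>x. pareto_density \<alpha> \<sigma> x \<partial>lborel) = 1"
    using nn_integral_pareto_density[OF assms] pareto_density_nonneg[OF assms]
    by (subst integral_eq_nn_integral) auto
qed

section \<open>The full-tails gamma density as a tempered Pareto density\<close>

text \<open>The Laplace-type integral \<open>I(\<rho>)\<close> that normalises the tempered Pareto density.\<close>
definition tempered_pareto_mass :: "real \<Rightarrow> real \<Rightarrow> real \<Rightarrow> real" where
  "tempered_pareto_mass \<alpha> \<sigma> \<rho> =
     (\<integral>x. pareto_density \<alpha> \<sigma> x * exp (- (\<rho> * (1 + x / \<sigma>))) \<partial>lborel)"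

text \<open>
  The affine change of variables \<open>t = \<rho> + (\<rho> / \<sigma>) x = \<rho> (1 + x / \<sigma>)\<close>, which maps the support of the
  Pareto density onto the domain of the incomplete gamma integral up to an endpoint.
\<close>
lemma upper_incomplete_Gamma_eq_tempered_pareto_mass:
  assumes "\<alpha> < 0" "\<sigma> > 0" "\<rho> > 0"
  shows "upper_incomplete_Gamma \<alpha> \<rho> = \<rho> powr \<alpha> / - \<alpha> * tempered_pareto_mass \<alpha> \<sigma> \<rho>"
proof -
  let ?G = "\<lambda>t. indicator {\<rho>..} t *\<^sub>R (t powr (\<alpha> - 1) * exp (- t))"
  have "upper_incomplete_Gamma \<alpha> \<rho> = \<bar>\<rho> / \<sigma>\<bar> *\<^sub>R (\<integral>x. ?G (\<rho> + \<rho> / \<sigma> * x) \<partial>lborel)"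
    unfolding upper_incomplete_Gamma_def set_lebesgue_integral_def
    using assms by (intro lborel_integral_real_affine) auto
  also have "(\<integral>x. ?G (\<rho> + \<rho> / \<sigma> * x) \<partial>lborel) =
      (\<integral>x. \<rho> powr (\<alpha> - 1) * \<sigma> / - \<alpha> *
             (pareto_density \<alpha> \<sigma> x * exp (- (\<rho> * (1 + x / \<sigma>)))) \<partial>lborel)"
  proof (rule integral_cong_AE)
    have "?G (\<rho> + \<rho> / \<sigma> * x) = \<rho> powr (\<alpha> - 1) * \<sigma> / - \<alpha> *
        (pareto_density \<alpha> \<sigma> x * exp (- (\<rho> * (1 + x / \<sigma>))))" if "x \<noteq> 0" for x
    proof (cases "x > 0")
      case True
      have "\<rho> + \<rho> / \<sigma> * x = \<rho> * (1 + x / \<sigma>)"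
        by (simp add: field_simps)
      moreover have "\<rho> \<le> \<rho> * (1 + x / \<sigma>)"
        using True assms by (simp add: field_simps)
      moreover have "(\<rho> * (1 + x / \<sigma>)) powr (\<alpha> - 1) = \<rho> powr (\<alpha> - 1) * (1 + x / \<sigma>) powr (\<alpha> - 1)"
        using True assms by (simp add: powr_mult)
      ultimately show ?thesis
        using True assms by (simp add: pareto_density_def)
    next
      case False
      with \<open>x \<noteq> 0\<close> have "\<rho> / \<sigma> * x < 0"
        using assms by (intro mult_pos_neg) auto
      then show ?thesis
        using False by (simp add: pareto_density_def)
    qed
    then show "AE x in lborel. ?G (\<rho> + \<rho> / \<sigma> * x) = \<rho> powr (\<alpha> - 1) * \<sigma> / - \<alpha> *
        (pareto_density \<alpha> \<sigma> x * exp (- (\<rho> * (1 + x / \<sigma>))))"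
      using AE_lborel_singleton[of "0::real"] by (auto elim: eventually_mono)
  qed measurable
  also have "\<dots> = \<rho> powr (\<alpha> - 1) * \<sigma> / - \<alpha> * tempered_pareto_mass \<alpha> \<sigma> \<rho>"
    unfolding tempered_pareto_mass_def by (rule integral_mult_right_zero)
  also have "\<bar>\<rho> / \<sigma>\<bar> *\<^sub>R (\<rho> powr (\<alpha> - 1) * \<sigma> / - \<alpha> * tempered_pareto_mass \<alpha> \<sigma> \<rho>) =
      \<rho> powr \<alpha> / - \<alpha> * tempered_pareto_mass \<alpha> \<sigma> \<rho>"
    using assms by (simp add: powr_diff)
  finally show ?thesis .
qed

lemma ftg_density_eq_tempered_pareto:
  assumes "\<alpha> < 0" "\<sigma> > 0" "\<rho> > 0"
  shows "ftg_density \<alpha> (\<rho> / \<sigma>) \<rho> x =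
    pareto_density \<alpha> \<sigma> x * exp (- (\<rho> * (1 + x / \<sigma>))) / tempered_pareto_mass \<alpha> \<sigma> \<rho>"
proof (cases "x > 0")
  case True
  have arg: "\<rho> + \<rho> / \<sigma> * x = \<rho> * (1 + x / \<sigma>)"
    by (simp add: field_simps)
  have "(\<rho> * (1 + x / \<sigma>)) powr (\<alpha> - 1) = \<rho> powr \<alpha> / \<rho> * (1 + x / \<sigma>) powr (\<alpha> - 1)"
    using True assms by (simp add: powr_mult powr_diff)
  then show ?thesis
    using True assms
    unfolding ftg_density_def pareto_density_def arg
      upper_incomplete_Gamma_eq_tempered_pareto_mass[OF assms]
    by (simp add: field_simps)
qed (simp add: ftg_density_def pareto_density_def)

lemma pareto_density_support: "pareto_density \<alpha> \<sigma> x \<noteq> 0 \<Longrightarrow> x > 0"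
  by (auto simp: pareto_density_def split: if_splits)

lemma integrable_tempered_pareto:
  assumes "\<alpha> < 0" "\<sigma> > 0" "\<rho> > 0"
  shows "integrable lborel (\<lambda>x. pareto_density \<alpha> \<sigma> x * exp (- (\<rho> * (1 + x / \<sigma>))))"
  using assms integrable_pareto_density[of \<alpha> \<sigma>]
  by (intro integrable_exp_tempered) (auto dest!: pareto_density_support)

lemma tempered_pareto_le:
  assumes "\<alpha> < 0" "\<sigma> > 0" "\<rho> > 0"
  shows "pareto_density \<alpha> \<sigma> x * exp (- (\<rho> * (1 + x / \<sigma>))) \<le> pareto_density \<alpha> \<sigma> x"
  using pareto_density_nonneg[of \<alpha> \<sigma> x] pareto_density_support[of \<alpha> \<sigma> x] assms
  by (cases "pareto_density \<alpha> \<sigma> x = 0") (auto intro!: mult_left_le)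

lemma tempered_pareto_mass_le_1:
  assumes "\<alpha> < 0" "\<sigma> > 0" "\<rho> > 0"
  shows "tempered_pareto_mass \<alpha> \<sigma> \<rho> \<le> 1"
proof -
  have "tempered_pareto_mass \<alpha> \<sigma> \<rho> \<le> (\<integral>x. pareto_density \<alpha> \<sigma> x \<partial>lborel)"
    unfolding tempered_pareto_mass_def using assms
    by (intro integral_mono integrable_tempered_pareto integrable_pareto_density tempered_pareto_le)
  then show ?thesis
    using assms by (simp add: integral_pareto_density)
qed

lemma tendsto_tempered_pareto_mass:
  assumes "\<alpha> < 0" "\<sigma> > 0"
  shows "(tempered_pareto_mass \<alpha> \<sigma> \<longlongrightarrow> 1) (at_right 0)"
proof -
  have "(tempered_pareto_mass \<alpha> \<sigma> \<longlongrightarrow> (\<integral>x. pareto_density \<alpha> \<sigma> x \<partial>lborel)) (at_right 0)"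
    unfolding tempered_pareto_mass_def[abs_def]
    using assms integrable_pareto_density[of \<alpha> \<sigma>]
    by (intro tendsto_integral_exp_tempered) (auto dest!: pareto_density_support)
  then show ?thesis
    using assms by (simp add: integral_pareto_density)
qed

lemma eventually_tempered_pareto_mass_pos:
  assumes "\<alpha> < 0" "\<sigma> > 0"
  shows "\<forall>\<^sub>F \<rho> in at_right 0. 0 < \<rho> \<and> 0 < tempered_pareto_mass \<alpha> \<sigma> \<rho>"
  using order_tendstoD(1)[OF tendsto_tempered_pareto_mass[OF assms], of 0]
    eventually_at_right_less[of "0::real"]
  by (auto elim: eventually_elim2)

section \<open>Distance and moments\<close>

text \<open>
  The minorant \<open>m = p e\<^sub>\<rho>\<close> of both densities gives \<open>\<bar>f - p\<bar> \<le> (f - m) + (p - m)\<close>, and each bracket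
  has integral \<open>1 - I(\<rho>)\<close>.
\<close>
lemma ftg_pareto_L1_distance_le:
  assumes "\<alpha> < 0" "\<sigma> > 0" "\<rho> > 0" and pos: "0 < tempered_pareto_mass \<alpha> \<sigma> \<rho>"
  shows "(\<integral>\<^sup>+x. ennreal \<bar>ftg_density \<alpha> (\<rho> / \<sigma>) \<rho> x - pareto_density \<alpha> \<sigma> x\<bar> \<partial>lborel)
    \<le> ennreal (2 * (1 - tempered_pareto_mass \<alpha> \<sigma> \<rho>))"
proof -
  define I where "I = tempered_pareto_mass \<alpha> \<sigma> \<rho>"
  define p where "p = pareto_density \<alpha> \<sigma>"
  define m where "m = (\<lambda>x. p x * exp (- (\<rho> * (1 + x / \<sigma>))))"
  note facts = assms(1-3)
  have I: "0 < I" "I \<le> 1"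
    using pos tempered_pareto_mass_le_1[OF facts] by (auto simp: I_def)
  have f: "ftg_density \<alpha> (\<rho> / \<sigma>) \<rho> x = m x / I" for x
    using ftg_density_eq_tempered_pareto[OF facts] by (simp add: m_def p_def I_def)
  have m: "0 \<le> m x" "m x \<le> p x" "m x \<le> m x / I" for x
  proof -
    show "0 \<le> m x"
      using pareto_density_nonneg[of \<alpha> \<sigma> x] facts by (simp add: m_def p_def)
    then show "m x \<le> m x / I"
      using I mult_left_le[of I "m x"] by (simp add: pos_le_divide_eq)
    show "m x \<le> p x"
      using tempered_pareto_le[OF facts] by (simp add: m_def p_def)
  qed
  have int [simp]: "integrable lborel m" "integrable lborel p"
    using integrable_tempered_pareto[OF facts] integrable_pareto_density[of \<alpha> \<sigma>] facts
    by (auto simp: m_def p_def)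
  have mass: "integral\<^sup>L lborel m = I" "integral\<^sup>L lborel p = 1"
    using integral_pareto_density[of \<alpha> \<sigma>] facts
    by (auto simp: m_def p_def I_def tempered_pareto_mass_def)
  have "(\<integral>\<^sup>+x. ennreal \<bar>m x / I - p x\<bar> \<partial>lborel)
      \<le> (\<integral>\<^sup>+x. ennreal ((m x / I - m x) + (p x - m x)) \<partial>lborel)"
  proof (intro nn_integral_mono ennreal_leI)
    fix x show "\<bar>m x / I - p x\<bar> \<le> (m x / I - m x) + (p x - m x)"
      using m(2,3)[of x] by linarith
  qed
  also have "\<dots> = ennreal (\<integral>x. (m x / I - m x) + (p x - m x) \<partial>lborel)"
    using m(2,3) by (intro nn_integral_eq_integral AE_I2 add_nonneg_nonneg) auto
  also have "(\<integral>x. (m x / I - m x) + (p x - m x) \<partial>lborel) = 2 * (1 - I)"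
    using I by (simp add: mass)
  finally show ?thesis
    by (simp add: f p_def I_def)
qed

lemma tendsto_ftg_moment:
  assumes "\<alpha> < 0" "\<sigma> > 0"
    and int: "integrable lborel (\<lambda>x. x ^ k * pareto_density \<alpha> \<sigma> x)"
  shows "((\<lambda>\<rho>. \<integral>\<^sup>+x. ennreal (x ^ k * ftg_density \<alpha> (\<rho> / \<sigma>) \<rho> x) \<partial>lborel) \<longlongrightarrow>
    ennreal (\<integral>x. x ^ k * pareto_density \<alpha> \<sigma> x \<partial>lborel)) (at_right 0)"
proof -
  define q where "q = (\<lambda>x. x ^ k * pareto_density \<alpha> \<sigma> x)"
  let ?I = "tempered_pareto_mass \<alpha> \<sigma>"
  let ?J = "\<lambda>\<rho>. \<integral>x. q x * exp (- (\<rho> * (1 + x / \<sigma>))) \<partial>lborel"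
  have q: "integrable lborel q"
    using int by (simp add: q_def)
  have q_nonneg: "0 \<le> q x" for x
    using pareto_density_nonneg[OF assms(1,2), of x] pareto_density_support[of \<alpha> \<sigma> x]
    by (cases "pareto_density \<alpha> \<sigma> x = 0") (auto simp: q_def)
  have supp: "0 \<le> 1 + x / \<sigma>" if "q x \<noteq> 0" for x
    using that pareto_density_support[of \<alpha> \<sigma> x] assms by (auto simp: q_def)
  have "((\<lambda>\<rho>. ?J \<rho> / ?I \<rho>) \<longlongrightarrow> integral\<^sup>L lborel q / 1) (at_right 0)"
    using tendsto_tempered_pareto_mass[OF assms(1,2)] supp
    by (intro tendsto_divide tendsto_integral_exp_tempered[OF q]) auto
  then have lim: "((\<lambda>\<rho>. ennreal (?J \<rho> / ?I \<rho>)) \<longlongrightarrow> ennreal (integral\<^sup>L lborel q)) (at_right 0)"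
    by (intro tendsto_ennrealI) simp
  have "\<forall>\<^sub>F \<rho> in at_right 0. ennreal (?J \<rho> / ?I \<rho>) =
      (\<integral>\<^sup>+x. ennreal (x ^ k * ftg_density \<alpha> (\<rho> / \<sigma>) \<rho> x) \<partial>lborel)"
    using eventually_tempered_pareto_mass_pos[OF assms(1,2)]
  proof eventually_elim
    case (elim \<rho>)
    have "(\<integral>\<^sup>+x. ennreal (x ^ k * ftg_density \<alpha> (\<rho> / \<sigma>) \<rho> x) \<partial>lborel) =
        (\<integral>\<^sup>+x. ennreal (q x * exp (- (\<rho> * (1 + x / \<sigma>))) / ?I \<rho>) \<partial>lborel)"
      using elim by (simp add: ftg_density_eq_tempered_pareto[OF assms(1,2)] q_def mult.assoc)
    also have "\<dots> = ennreal (\<integral>x. q x * exp (- (\<rho> * (1 + x / \<sigma>))) / ?I \<rho> \<partial>lborel)"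
      using elim q_nonneg integrable_exp_tempered[OF q _ supp, where \<rho> = \<rho>]
      by (intro nn_integral_eq_integral integrable_divide AE_I2 divide_nonneg_nonneg) auto
    finally show ?case
      by simp
  qed
  from Lim_transform_eventually[OF lim this] show ?thesis
    by (simp add: q_def)
qed

text \<open>
  Both densities vanish outside \<open>{0<..}\<close>, so the integrals over the half-line agree with those over
  the whole line.
\<close>
theorem theorem1:
  fixes \<alpha> \<sigma> :: real
  assumes "\<alpha> < 0" and "\<sigma> > 0"
  shows "((\<lambda>\<rho>. \<integral>\<^sup>+x\<in>{0<..}. ennreal \<bar>ftg_density \<alpha> (\<rho> / \<sigma>) \<rho> x - pareto_density \<alpha> \<sigma> x\<bar> \<partial>lborel)
            \<longlongrightarrow> 0) (at_right 0)
       \<and> (\<forall>k::nat. k > 0 \<longrightarrow>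
            (\<integral>\<^sup>+x\<in>{0<..}. ennreal (x ^ k * pareto_density \<alpha> \<sigma> x) \<partial>lborel) < \<infinity> \<longrightarrow>
            ((\<lambda>\<rho>. \<integral>\<^sup>+x\<in>{0<..}. ennreal (x ^ k * ftg_density \<alpha> (\<rho> / \<sigma>) \<rho> x) \<partial>lborel)
              \<longlongrightarrow> (\<integral>\<^sup>+x\<in>{0<..}. ennreal (x ^ k * pareto_density \<alpha> \<sigma> x) \<partial>lborel)) (at_right 0))"
proof (intro conjI allI impI)
  let ?D = "\<lambda>\<rho>. \<integral>\<^sup>+x\<in>{0<..}. ennreal \<bar>ftg_density \<alpha> (\<rho> / \<sigma>) \<rho> x - pareto_density \<alpha> \<sigma> x\<bar> \<partial>lborel"
  let ?I = "tempered_pareto_mass \<alpha> \<sigma>"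
  have D: "?D \<rho> = (\<integral>\<^sup>+x. ennreal \<bar>ftg_density \<alpha> (\<rho> / \<sigma>) \<rho> x - pareto_density \<alpha> \<sigma> x\<bar> \<partial>lborel)" for \<rho>
    by (intro nn_integral_cong) (auto simp: ftg_density_def pareto_density_def indicator_def)
  have "((\<lambda>\<rho>. 2 * (1 - ?I \<rho>)) \<longlongrightarrow> 2 * (1 - 1)) (at_right 0)"
    by (intro tendsto_intros tendsto_tempered_pareto_mass assms)
  then have bound: "((\<lambda>\<rho>. ennreal (2 * (1 - ?I \<rho>))) \<longlongrightarrow> 0) (at_right 0)"
    using tendsto_ennrealI by fastforce
  have "\<forall>\<^sub>F \<rho> in at_right 0. ?D \<rho> \<le> ennreal (2 * (1 - ?I \<rho>))"
    using eventually_tempered_pareto_mass_pos[OF assms]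
    by eventually_elim (use D ftg_pareto_L1_distance_le[OF assms] in auto)
  then show "(?D \<longlongrightarrow> 0) (at_right 0)"
    by (intro tendsto_sandwich[OF _ _ tendsto_const bound]) auto
next
  fix k :: nat
  assume fin: "(\<integral>\<^sup>+x\<in>{0<..}. ennreal (x ^ k * pareto_density \<alpha> \<sigma> x) \<partial>lborel) < \<infinity>"
  let ?q = "\<lambda>x. x ^ k * pareto_density \<alpha> \<sigma> x"
  have q_nonneg: "0 \<le> ?q x" for x
    using pareto_density_nonneg[OF assms, of x] pareto_density_support[of \<alpha> \<sigma> x]
    by (cases "pareto_density \<alpha> \<sigma> x = 0") auto
  have P: "(\<integral>\<^sup>+x\<in>{0<..}. ennreal (?q x) \<partial>lborel) = (\<integral>\<^sup>+x. ennreal (?q x) \<partial>lborel)"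
    by (intro nn_integral_cong) (auto simp: pareto_density_def indicator_def)
  have F: "(\<integral>\<^sup>+x\<in>{0<..}. ennreal (x ^ k * ftg_density \<alpha> (\<rho> / \<sigma>) \<rho> x) \<partial>lborel) =
      (\<integral>\<^sup>+x. ennreal (x ^ k * ftg_density \<alpha> (\<rho> / \<sigma>) \<rho> x) \<partial>lborel)" for \<rho>
    by (intro nn_integral_cong) (auto simp: ftg_density_def indicator_def)
  have int: "integrable lborel ?q"
    using fin q_nonneg unfolding P by (intro integrableI_nonneg) auto
  have "(\<integral>\<^sup>+x. ennreal (?q x) \<partial>lborel) = ennreal (\<integral>x. ?q x \<partial>lborel)"
    using int q_nonneg by (intro nn_integral_eq_integral) auto
  then show "((\<lambda>\<rho>. \<integral>\<^sup>+x\<in>{0<..}. ennreal (x ^ k * ftg_density \<alpha> (\<rho> / \<sigma>) \<rho> x) \<partial>lborel)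
      \<longlongrightarrow> (\<integral>\<^sup>+x\<in>{0<..}. ennreal (?q x) \<partial>lborel)) (at_right 0)"
    unfolding P F using tendsto_ftg_moment[OF assms int] by simp
qed

end
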